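(* Let $\gamma\in(1/2,1)$ and $k\in(1,\infty)$ with $\frac12+\frac1{2k}>\gamma$, let $\mathcal{N}\subset\mathbb{R}$ be a neighborhood of $0$, and let $f:\mathbb{R}\to\mathbb{R}$ satisfy $|x|^k\le f(x)$ for all $x\in\mathcal{N}$. Let $(\mathscr{F}_n)_{n\ge1}$ be a filtration and let $(X_n)_{n\ge 1}$, $(Y_n)_{n\ge 1}$ be real-valued processes adapted to it such that for all $n\ge1$, almost surely, $$X_{n+1}-X_n\ge\frac{f(X_n)}{n^{\gamma}}+\frac{Y_{n+1}}{n^{\gamma}},$$ where there are constants $M<\infty$ and $l>0$ such that for all $n$: $|Y_n|<M$ a.s., $E(Y_{n+1}\mid\mathscr{F}_n)=0$, and $E(Y_{n+1}^2\mid\mathscr{F}_n)\ge l$. Then $\mathbb{P}(X_n\to0)=0$. *)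

theory Defs
  imports "HOL-Probability.Probability" "HOL-Probability.Stopping_Time"
begin

end

theory Submission
  imports Defs "HOL-Real_Asymp.Real_Asymp"
begin

text \<open>
  Why the theorem holds. Write \<open>g j = j powr - \<gamma>\<close> for the step sizes, \<open>W n N\<close> for the sum of
  \<open>g j * Y (Suc j)\<close> over \<open>n \<le> j < N\<close>, and \<open>V n N\<close> for the sum of the \<open>(g j)\<^sup>2\<close>. Near \<open>0\<close> the drift pushes
  upwards, so \<open>X\<close> can only settle at \<open>0\<close> from below; but the noise keeps moving \<open>X n\<close> away from \<open>0\<close>
  by about \<open>n powr (1/2 - \<gamma>)\<close>, the square root of \<open>V n (2 * n)\<close>, while a path that has to absorb the
  upward drift \<open>\<bar>x\<bar> powr k\<close> and still stay at or below \<open>0\<close> must decay like the negative solutions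
  of \<open>x' = \<bar>x\<bar> powr k\<close> at time \<open>n powr (1 - \<gamma>)\<close>, that is, at rate \<open>n powr (- (1 - \<gamma>) / (k - 1))\<close>. The hypothesis
  \<open>\<gamma> < 1/2 + 1/(2*k)\<close> says precisely that the second rate is smaller than the first.

  The argument is carried out in expectation on the event \<open>B\<close> that \<open>\<bar>X m\<bar> \<le> \<epsilon>\<close> for all \<open>m \<ge> n0\<close>, where
  \<open>[-\<epsilon>, \<epsilon>]\<close> lies in the neighbourhood on which the drift is controlled. If \<open>X\<close> tends to \<open>0\<close> then some
  such event occurs, so it suffices that each \<open>B\<close> is null (\<open>confined_paths_null\<close>). Suppose \<open>B\<close> has
  positive probability and let \<open>a n\<close> be the expectation of \<open>\<bar>X n\<bar>\<close> on \<open>B\<close>. Summing the recursion on \<open>B\<close>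
  gives \<open>X n + (sum of g j * \<bar>X j\<bar> powr k) + W n N \<le> X N\<close>. The event \<open>B\<close> looks into the future, but it
  is the decreasing limit of the events \<open>Bn n\<close> that confinement holds up to time \<open>n\<close>, which are known
  at time \<open>n\<close>. On \<open>Bn n\<close> the noise \<open>W n N\<close> has mean \<open>0\<close> and, by comparing its second and fourth
  moments (\<open>expectation_abs_W_ge\<close>), absolute mean at least a multiple of \<open>sqrt (V n N)\<close>; the
  difference \<open>Bn n - B\<close> has small probability and so contributes only a small multiple of
  \<open>sqrt (V n N)\<close> (\<open>expectation_abs_W_on_small_set\<close>). With the convexity of \<open>powr k\<close> for the drift this yields,
  for some \<open>\<kappa> > 0\<close> and all large \<open>n \<le> N\<close>,
  \<open>\<kappa> * sqrt (V n N) \<le> a n + a N\<close> and \<open>(sum of g j * a j powr k) \<le> 2 * (a n + a N)\<close>.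
  No bounded nonnegative sequence satisfies both (\<open>drift_and_noise_bounds_incompatible\<close>).
\<close>

section \<open>Two incompatible decay bounds for a real sequence\<close>

text \<open>
  The tangent line of \<open>x powr k\<close> at \<open>s\<close>, including the boundary point \<open>s = 0\<close>. It replaces Jensen's
  inequality when the mass of the underlying measure is below \<open>1\<close>.
\<close>

lemma powr_tangent_le:
  fixes x s k :: real
  assumes "1 < k" "0 \<le> x" "0 \<le> s"
  shows "s powr k + k * s powr (k - 1) * (x - s) \<le> x powr k"
proof (cases "s = 0")
  case False
  then have s: "s > 0" using assms by simp
  have "x * s powr (k - 1) \<le> x powr k / k + (s powr (k - 1)) powr (k / (k - 1)) / (k / (k - 1))"
    by (rule Youngs_inequality) (use assms in \<open>auto simp: field_simps\<close>)
  also have "(s powr (k - 1)) powr (k / (k - 1)) = s powr k"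
    using assms by (simp add: powr_powr)
  finally have "k * (x * s powr (k - 1)) \<le> x powr k + (k - 1) * s powr k"
    using assms by (simp add: field_simps)
  moreover have "s powr (k - 1) * s = s powr k"
    using s by (simp add: powr_mult_base mult.commute)
  ultimately show ?thesis by (simp add: algebra_simps)
qed (use assms in auto)

text \<open>
  The discrete counterpart of solving \<open>s' = - d * s powr k\<close> by separation of variables: each step
  that lowers \<open>s\<close> to \<open>t\<close> by at least \<open>d * s powr k\<close> raises \<open>s powr (1 - k)\<close> by at least \<open>(k - 1) * d\<close>.
\<close>

lemma powr_one_minus_step:
  fixes s t d k :: real
  assumes k: "1 < k" and t: "0 < t" and s: "0 < s" and d: "0 \<le> d"
    and step: "t + d * s powr k \<le> s"
  shows "s powr (1 - k) + (k - 1) * d \<le> t powr (1 - k)"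
proof -
  have "ln (t / s) \<le> t / s - 1"
    by (rule ln_le_minus_one) (use s t in auto)
  also have "\<dots> \<le> - (d * s powr k / s)"
  proof -
    have "(t + d * s powr k) / s \<le> s / s" using step s by (intro divide_right_mono) auto
    then show ?thesis using s by (simp add: add_divide_distrib)
  qed
  finally have "(k - 1) * (d * s powr k / s) \<le> (k - 1) * - ln (t / s)"
    using k by (intro mult_left_mono) auto
  then have "1 + (k - 1) * (d * s powr k / s) \<le> 1 + (1 - k) * ln (t / s)"
    by (simp add: algebra_simps)
  also have "\<dots> \<le> exp ((1 - k) * ln (t / s))" by (rule exp_ge_add_one_self)
  also have "\<dots> = (t / s) powr (1 - k)" using s t by (simp add: powr_def)
  finally have "s powr (1 - k) * (1 + (k - 1) * (d * s powr k / s)) \<le> s powr (1 - k) * (t / s) powr (1 - k)"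
    by (intro mult_left_mono) auto
  moreover have "s powr (1 - k) * (t / s) powr (1 - k) = t powr (1 - k)"
    using s t by (simp add: powr_divide)
  moreover have unit: "s powr (1 - k) * (s powr k / s) = 1"
    using s by (simp add: powr_diff)
  have "s powr (1 - k) * (1 + (k - 1) * (d * s powr k / s))
      = s powr (1 - k) + (k - 1) * d * (s powr (1 - k) * (s powr k / s))"
    by (simp add: distrib_left mult_ac)
  then have "s powr (1 - k) * (1 + (k - 1) * (d * s powr k / s)) = s powr (1 - k) + (k - 1) * d"
    unfolding unit by simp
  ultimately show ?thesis by simp
qed

lemma sum_double_block_ge:
  fixes h :: "nat \<Rightarrow> real"
  assumes "\<And>m. n \<le> m \<Longrightarrow> m < 2 * n \<Longrightarrow> c \<le> h m"
  shows "real n * c \<le> sum h {n..<2 * n}"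
  using sum_bounded_below[of "{n..<2*n}" c h] assms by simp

text \<open>
  The drift bound first makes \<open>g j * a j powr k\<close> summable. As the step sizes \<open>g j\<close> are not summable,
  \<open>a\<close> gets arbitrarily small at late times \<open>N\<close>, and \<open>a N\<close> can be dropped from both bounds. The noise
  bound then reads \<open>c * n powr (1/2 - \<gamma>) \<le> a n\<close>, and the drift bound says that the tail sums
  \<open>S n\<close> of \<open>g j * a j powr k\<close> satisfy \<open>S n \<le> 2 * a n\<close>. Hence \<open>S n - S (Suc n) \<ge> g n * (S n / 2) powr k\<close>, which
  forces \<open>S (2 * n) powr (1 - k)\<close> to be at least of order \<open>n powr (1 - \<gamma>)\<close>. The noise bound forces
  \<open>S n\<close> to be at least of order \<open>n powr e\<close> with \<open>e = 1 - \<gamma> + k * (1/2 - \<gamma>)\<close>. These two collide because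
  \<open>e * (1 - k) < 1 - \<gamma>\<close> is equivalent to \<open>\<gamma> < 1/2 + 1/(2*k)\<close>.
\<close>

lemma drift_and_noise_bounds_incompatible:
  fixes a :: "nat \<Rightarrow> real" and \<gamma> k \<kappa> A :: real and n0 :: nat
  assumes gamma: "1/2 < \<gamma>" "\<gamma> < 1" and k: "1 < k" and gk: "\<gamma> < 1/2 + 1/(2*k)"
    and n0: "1 \<le> n0" and \<kappa>: "0 < \<kappa>"
    and a0: "\<And>n. 0 \<le> a n" and aA: "\<And>n. n0 \<le> n \<Longrightarrow> a n \<le> A"
    and noise: "\<And>n N. n0 \<le> n \<Longrightarrow> n \<le> N \<Longrightarrow>
       \<kappa> * sqrt (\<Sum>j\<in>{n..<N}. (real j powr - \<gamma>)\<^sup>2) \<le> a n + a N"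
    and drift: "\<And>n N. n0 \<le> n \<Longrightarrow> n \<le> N \<Longrightarrow>
       (\<Sum>j\<in>{n..<N}. real j powr - \<gamma> * a j powr k) \<le> 2 * (a n + a N)"
  shows False
proof -
  define h where "h j = real j powr - \<gamma> * a j powr k" for j
  have h0: "0 \<le> h j" for j by (simp add: h_def)
  have "summable (\<lambda>i. h (i + n0))"
  proof (rule summableI_nonneg_bounded[where x = "4 * A"])
    fix n
    have "(\<Sum>i<n. h (i + n0)) = sum h {n0..<n0 + n}"
      using sum.shift_bounds_nat_ivl[of h 0 n0 n] by (simp add: lessThan_atLeast0 add.commute)
    also have "\<dots> \<le> 2 * (a n0 + a (n0 + n))" unfolding h_def by (rule drift) (use n0 in auto)
    also have "\<dots> \<le> 4 * A" using aA[of n0] aA[of "n0 + n"] by simp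
    finally show "(\<Sum>i<n. h (i + n0)) \<le> 4 * A" .
  qed (simp add: h0)
  then have summ: "summable h" by simp
  have small: "\<exists>N\<ge>n. a N < e" if "0 < e" "n \<ge> n0" for e n
  proof (rule ccontr)
    assume "\<not> ?thesis"
    then have ge: "\<And>m. m \<ge> n \<Longrightarrow> e \<le> a m" by force
    have "summable (\<lambda>j. e powr k * real j powr - \<gamma>)"
    proof (rule summable_comparison_test'[OF summ])
      fix m assume "n \<le> m"
      then have "e powr k \<le> a m powr k" using ge that k by (intro powr_mono2) auto
      then show "norm (e powr k * real m powr - \<gamma>) \<le> h m"
        by (simp add: h_def mult.commute mult_right_mono)
    qed
    then have "summable (\<lambda>j. real j powr - \<gamma>)"
      using that by (simp add: summable_cmult_iff)
    then show False using summable_real_powr_iff[of "- \<gamma>"] gamma by simp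
  qed
  \<comment> \<open>Both left-hand sides grow with \<open>N\<close>, so \<open>N\<close> may be moved to a time \<open>N'\<close> with \<open>a N'\<close> negligible.\<close>
  have noise': "\<kappa> * sqrt (\<Sum>j\<in>{n..<N}. (real j powr - \<gamma>)\<^sup>2) \<le> a n" if n: "n0 \<le> n" for n N
  proof (rule field_le_epsilon)
    fix e :: real assume "0 < e"
    then obtain N' where N': "N' \<ge> max n N" "a N' < e" using small[of e "max n N"] n by (auto simp: le_max_iff_disj)
    have "\<kappa> * sqrt (\<Sum>j\<in>{n..<N}. (real j powr - \<gamma>)\<^sup>2) \<le> \<kappa> * sqrt (\<Sum>j\<in>{n..<N'}. (real j powr - \<gamma>)\<^sup>2)"
      using N' \<kappa> by (intro mult_left_mono real_sqrt_le_mono sum_mono2) auto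
    also have "\<dots> \<le> a n + a N'" using N' n by (intro noise) auto
    finally show "\<kappa> * sqrt (\<Sum>j\<in>{n..<N}. (real j powr - \<gamma>)\<^sup>2) \<le> a n + e" using N' by simp
  qed
  have drift': "sum h {n..<N} \<le> 2 * a n" if n: "n0 \<le> n" for n N
  proof (rule field_le_epsilon)
    fix e :: real assume "0 < e"
    then obtain N' where N': "N' \<ge> max n N" "a N' < e / 2" using small[of "e/2" "max n N"] n by (auto simp: le_max_iff_disj)
    have "sum h {n..<N} \<le> sum h {n..<N'}"
      using N' h0 by (intro sum_mono2) auto
    also have "\<dots> \<le> 2 * (a n + a N')" unfolding h_def using N' n by (intro drift) auto
    finally show "sum h {n..<N} \<le> 2 * a n + e" using N' by simp
  qed
  define S where "S n = (\<Sum>i. h (i + n))" for n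
  have summS: "summable (\<lambda>i. h (i + n))" for n using summ by simp
  have part: "sum h {n..<N} = (\<Sum>i<N - n. h (i + n))" for n N
    using sum.shift_bounds_nat_ivl[of h 0 n "N - n"]
    by (cases "n \<le> N") (auto simp: lessThan_atLeast0)
  have S_ge: "sum h {n..<N} \<le> S n" for n N
    unfolding S_def part by (rule sum_le_suminf[OF summS]) (auto simp: h0)
  have S_le: "S n \<le> 2 * a n" if "n0 \<le> n" for n
    unfolding S_def
  proof (rule suminf_le_const[OF summS])
    fix i show "(\<Sum>j<i. h (j + n)) \<le> 2 * a n"
      using drift'[OF that, of "n + i"] part[of n "n + i"] by simp
  qed
  have S_Suc: "S n = h n + S (Suc n)" for n
    unfolding S_def using suminf_split_head[OF summS[of n]] by simp
  define c where "c = \<kappa> * 2 powr - \<gamma>"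
  have c: "0 < c" using \<kappa> by (simp add: c_def)
  have a_ge: "c * real n powr (1/2 - \<gamma>) \<le> a n" if n: "n0 \<le> n" for n
  proof -
    have n1: "real n > 0" using n n0 by simp
    have "real n * ((2 * real n) powr - \<gamma>)\<^sup>2 \<le> (\<Sum>j\<in>{n..<2 * n}. (real j powr - \<gamma>)\<^sup>2)"
    proof (rule sum_double_block_ge)
      fix m assume "n \<le> m" "m < 2 * n"
      then show "((2 * real n) powr - \<gamma>)\<^sup>2 \<le> (real m powr - \<gamma>)\<^sup>2"
        using n1 gamma by (intro power_mono powr_mono2') auto
    qed
    then have "sqrt (real n * ((2 * real n) powr - \<gamma>)\<^sup>2) \<le> sqrt (\<Sum>j\<in>{n..<2 * n}. (real j powr - \<gamma>)\<^sup>2)"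
      by (rule real_sqrt_le_mono)
    also have "sqrt (real n * ((2 * real n) powr - \<gamma>)\<^sup>2) = real n powr (1/2) * (2 * real n) powr - \<gamma>"
      using n1 by (simp add: real_sqrt_mult powr_half_sqrt)
    also have "\<dots> = 2 powr - \<gamma> * real n powr (1/2 - \<gamma>)"
      using n1 by (simp add: powr_mult powr_add[symmetric])
    finally have "\<kappa> * (2 powr - \<gamma> * real n powr (1/2 - \<gamma>)) \<le> \<kappa> * sqrt (\<Sum>j\<in>{n..<2 * n}. (real j powr - \<gamma>)\<^sup>2)"
      using \<kappa> by (intro mult_left_mono) auto
    also have "\<dots> \<le> a n" by (rule noise'[OF n])
    finally show ?thesis by (simp add: c_def mult.assoc)
  qed
  define C where "C = (c * 2 powr (1/2 - \<gamma>)) powr k * 2 powr - \<gamma>"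
  define e where "e = 1 - \<gamma> + k * (1/2 - \<gamma>)"
  have C: "0 < C" using c by (simp add: C_def)
  have S_lower: "C * real n powr e \<le> S n" if n: "n0 \<le> n" for n
  proof -
    have n1: "real n > 0" using n n0 by simp
    have "real n * ((2 * real n) powr - \<gamma> * (c * (2 * real n) powr (1/2 - \<gamma>)) powr k) \<le> sum h {n..<2 * n}"
    proof (rule sum_double_block_ge)
      fix m assume m: "n \<le> m" "m < 2 * n"
      have "c * (2 * real n) powr (1/2 - \<gamma>) \<le> c * real m powr (1/2 - \<gamma>)"
        using n1 gamma m c by (intro mult_left_mono powr_mono2') auto
      also have "\<dots> \<le> a m" using m n by (intro a_ge) auto
      finally have "(c * (2 * real n) powr (1/2 - \<gamma>)) powr k \<le> a m powr k"
        using c k by (intro powr_mono2) auto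
      moreover have "(2 * real n) powr - \<gamma> \<le> real m powr - \<gamma>"
        using n1 gamma m by (intro powr_mono2') auto
      ultimately show "(2 * real n) powr - \<gamma> * (c * (2 * real n) powr (1/2 - \<gamma>)) powr k \<le> h m"
        unfolding h_def by (intro mult_mono) auto
    qed
    also have "\<dots> \<le> S n" by (rule S_ge)
    also have "real n * ((2 * real n) powr - \<gamma> * (c * (2 * real n) powr (1/2 - \<gamma>)) powr k) = C * (real n powr 1 * real n powr - \<gamma> * real n powr ((1/2 - \<gamma>) * k))"
      using n1 c by (simp add: C_def powr_mult powr_powr mult_ac)
    also have "\<dots> = C * real n powr e"
      using n1 by (simp only: powr_add[symmetric]) (simp add: e_def algebra_simps)
    finally show ?thesis .
  qed
  have S_pos: "0 < S n" if "n0 \<le> n" for n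
  proof -
    have "0 < C * real n powr e" using C n0 that by simp
    with S_lower[OF that] show ?thesis by linarith
  qed
  define R where "R n = S n powr (1 - k)" for n
  define q where "q = (k - 1) * 2 powr - k"
  have q: "0 < q" using k by (simp add: q_def)
  have R_step: "R n + q * real n powr - \<gamma> \<le> R (Suc n)" if n: "n0 \<le> n" for n
  proof -
    have "real n powr - \<gamma> * 2 powr - k * S n powr k = real n powr - \<gamma> * (S n / 2) powr k"
      using S_pos[OF n] by (simp add: powr_divide powr_minus_divide)
    also have "\<dots> \<le> h n"
      unfolding h_def using S_le[OF n] S_pos[OF n] k by (intro mult_left_mono powr_mono2) auto
    finally have "S (Suc n) + (real n powr - \<gamma> * 2 powr - k) * S n powr k \<le> S n"
      using S_Suc[of n] by simp
    from powr_one_minus_step[OF k _ _ _ this] S_pos[OF n] S_pos[of "Suc n"] n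
    show ?thesis by (simp add: R_def q_def mult_ac)
  qed
  have R_sum: "(\<Sum>j\<in>{n..<n + i}. q * real j powr - \<gamma>) \<le> R (n + i)" if n: "n0 \<le> n" for n i
  proof (induction i)
    case (Suc i)
    then show ?case using R_step[of "n + i"] n by simp
  qed (simp add: R_def)
  define D where "D = C powr (1 - k) * 2 powr (e * (1 - k))"
  have key: "q * 2 powr - \<gamma> * real n powr (1 - \<gamma>) \<le> D * real n powr (e * (1 - k))" if n: "n0 \<le> n" for n
  proof -
    have n1: "real n > 0" using n n0 by simp
    have "q * 2 powr - \<gamma> * real n powr (1 - \<gamma>) = real n * (q * (2 * real n) powr - \<gamma>)"
      using n1 by (simp add: powr_mult powr_diff powr_minus_divide)
    also have "\<dots> \<le> (\<Sum>j\<in>{n..<2 * n}. q * real j powr - \<gamma>)"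
    proof (rule sum_double_block_ge)
      fix m assume "n \<le> m" "m < 2 * n"
      then show "q * (2 * real n) powr - \<gamma> \<le> q * real m powr - \<gamma>"
        using n1 gamma q by (intro mult_left_mono powr_mono2') auto
    qed
    also have "\<dots> \<le> R (2 * n)" using R_sum[OF n, of n] by (simp add: mult_2)
    also have "\<dots> \<le> (C * real (2 * n) powr e) powr (1 - k)"
      unfolding R_def using S_lower[of "2 * n"] C n1 n k by (intro powr_mono2') auto
    also have "\<dots> = D * real n powr (e * (1 - k))"
      using n1 C by (simp add: D_def powr_mult powr_powr)
    finally show ?thesis .
  qed
  have expo: "e * (1 - k) < 1 - \<gamma>"
  proof -
    have "k * (2 * \<gamma> - 1) < 1" using gk k by (simp add: field_simps)
    then have "0 < k * ((1 - \<gamma>) - (k - 1) * (\<gamma> - 1/2))"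
      using k by (intro mult_pos_pos) (auto simp: algebra_simps diff_divide_distrib)
    then show ?thesis by (simp add: e_def algebra_simps diff_divide_distrib)
  qed
  define \<delta> where "\<delta> = 1 - \<gamma> - e * (1 - k)"
  have "\<delta> > 0" using expo by (simp add: \<delta>_def)
  then have "filterlim (\<lambda>n. real n powr \<delta>) at_top sequentially" by real_asymp
  then have "eventually (\<lambda>n. D / (q * 2 powr - \<gamma>) < real n powr \<delta>) sequentially"
    by (simp add: filterlim_at_top_dense)
  then obtain n where n: "n \<ge> n0" "D / (q * 2 powr - \<gamma>) < real n powr \<delta>"
    using eventually_conj[OF eventually_ge_at_top[of n0]] eventually_happens' sequentially_bot by blast
  have n1: "real n > 0" using n n0 by simp
  have "real n powr (1 - \<gamma>) = real n powr \<delta> * real n powr (e * (1 - k))"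
    using n1 by (simp add: powr_add[symmetric] \<delta>_def)
  with key[OF n(1)] n1 have "q * 2 powr - \<gamma> * real n powr \<delta> \<le> D"
    by (simp add: mult.assoc[symmetric])
  with n(2) q show False by (simp add: field_simps)
qed

section \<open>Essentially bounded functions\<close>

text \<open>
  Every integrand below is built from indicators, the bounded noise and the confined process by
  products and sums. Essential boundedness, unlike integrability, is preserved by products, so it
  gives integrability by a purely syntactic search.
\<close>

definition ess_bounded :: "'a measure \<Rightarrow> ('a \<Rightarrow> real) \<Rightarrow> bool" where
  "ess_bounded P f \<longleftrightarrow> f \<in> borel_measurable P \<and> (\<exists>C. AE x in P. \<bar>f x\<bar> \<le> C)"

lemma ess_boundedI: "f \<in> borel_measurable P \<Longrightarrow> AE x in P. \<bar>f x\<bar> \<le> C \<Longrightarrow> ess_bounded P f"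
  by (auto simp: ess_bounded_def)

lemma ess_bounded_measurable: "ess_bounded P f \<Longrightarrow> f \<in> borel_measurable P"
  by (simp add: ess_bounded_def)

lemma ess_bounded_integrable: "finite_measure P \<Longrightarrow> ess_bounded P f \<Longrightarrow> integrable P f"
  unfolding ess_bounded_def real_norm_def[symmetric]
  using finite_measure.integrable_const_bound by blast

lemma ess_bounded_const: "ess_bounded P (\<lambda>x. c)"
  by (rule ess_boundedI[where C = "\<bar>c\<bar>"]) auto

lemma ess_bounded_indicator: "A \<in> sets P \<Longrightarrow> ess_bounded P (indicat_real A)"
  by (rule ess_boundedI[where C = 1]) (auto simp: indicator_def)

lemma ess_bounded_abs: "ess_bounded P f \<Longrightarrow> ess_bounded P (\<lambda>x. \<bar>f x\<bar>)"
  by (auto simp: ess_bounded_def)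

lemma ess_bounded_add:
  assumes "ess_bounded P f" "ess_bounded P g"
  shows "ess_bounded P (\<lambda>x. f x + g x)"
proof -
  obtain C D where "AE x in P. \<bar>f x\<bar> \<le> C" "AE x in P. \<bar>g x\<bar> \<le> D"
    using assms by (auto simp: ess_bounded_def)
  then have "AE x in P. \<bar>f x + g x\<bar> \<le> C + D" by eventually_elim linarith
  then show ?thesis
    using assms by (intro ess_boundedI) (auto simp: ess_bounded_def)
qed

lemma ess_bounded_mult:
  assumes "ess_bounded P f" "ess_bounded P g"
  shows "ess_bounded P (\<lambda>x. f x * g x)"
proof -
  obtain C D where "AE x in P. \<bar>f x\<bar> \<le> C" "AE x in P. \<bar>g x\<bar> \<le> D"
    using assms by (auto simp: ess_bounded_def)
  then have "AE x in P. \<bar>f x * g x\<bar> \<le> C * D"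
    by eventually_elim (simp add: abs_mult mult_mono')
  then show ?thesis
    using assms by (intro ess_boundedI) (auto simp: ess_bounded_def)
qed

lemma ess_bounded_divide: "ess_bounded P f \<Longrightarrow> ess_bounded P (\<lambda>x. f x / c)"
  unfolding divide_inverse by (intro ess_bounded_mult ess_bounded_const)

lemma ess_bounded_power: "ess_bounded P f \<Longrightarrow> ess_bounded P (\<lambda>x. f x ^ i)"
  by (induction i) (auto intro: ess_bounded_const ess_bounded_mult)

lemma ess_bounded_sum:
  assumes "\<And>i. i \<in> I \<Longrightarrow> ess_bounded P (f i)"
  shows "ess_bounded P (\<lambda>x. \<Sum>i\<in>I. f i x)"
  using assms
  by (induction I rule: infinite_finite_induct) (auto intro: ess_bounded_const ess_bounded_add)

lemmas ess_bounded_intros = ess_bounded_const ess_bounded_indicator ess_bounded_abs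
  ess_bounded_add ess_bounded_mult ess_bounded_divide ess_bounded_power ess_bounded_sum

section \<open>Moments of the accumulated noise\<close>

text \<open>
  The odd term \<open>4 * w * z ^ 3\<close> of the binomial expansion is absorbed by
  \<open>0 \<le> 2 * (z * (w - z))\<^sup>2\<close>, so that only even powers of \<open>w\<close> remain besides the term
  \<open>w ^ 3 * z\<close>, which has mean \<open>0\<close> when \<open>z\<close> is a martingale increment.
\<close>

lemma fourth_power_add_le:
  fixes w z b :: real
  assumes "z\<^sup>2 \<le> b"
  shows "(w + z) ^ 4 \<le> w ^ 4 + 4 * (w ^ 3 * z) + 8 * b * w\<^sup>2 + 3 * b\<^sup>2"
proof -
  have "0 \<le> 2 * (z * (w - z))\<^sup>2" by simp
  moreover have "w ^ 4 + 4 * (w ^ 3 * z) + 8 * z\<^sup>2 * w\<^sup>2 + 3 * (z\<^sup>2)\<^sup>2 - (w + z) ^ 4 = 2 * (z * (w - z))\<^sup>2"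
    by algebra
  moreover have "z\<^sup>2 * w\<^sup>2 \<le> b * w\<^sup>2" using assms by (intro mult_right_mono) auto
  moreover have "(z\<^sup>2)\<^sup>2 \<le> b\<^sup>2" using assms by (intro power_mono) auto
  ultimately show ?thesis by linarith
qed

text \<open>
  At scale \<open>s\<close> this is \<open>t\<^sup>2 - t ^ 4 \<le> t\<close> for \<open>t \<ge> 0\<close>. It bounds a first absolute moment from below by
  a lower bound on the second and an upper bound on the fourth moment.
\<close>

lemma abs_ge_square_minus_fourth:
  fixes w s :: real
  assumes "0 < s"
  shows "w\<^sup>2 / s - w ^ 4 / s ^ 3 \<le> \<bar>w\<bar>"
proof -
  define t where "t = \<bar>w\<bar> / s"
  have t0: "0 \<le> t" using assms by (simp add: t_def)
  have "t\<^sup>2 - t ^ 4 \<le> t"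
  proof (cases "t \<le> 1")
    case True
    then have "t\<^sup>2 \<le> t" using t0 by (simp add: power2_eq_square mult_left_le)
    moreover have "0 \<le> t ^ 4" using t0 by simp
    ultimately show ?thesis by linarith
  next
    case False
    then have "t\<^sup>2 \<le> t ^ 4" by (intro power_increasing) auto
    then show ?thesis using t0 by linarith
  qed
  then have "s * (t\<^sup>2 - t ^ 4) \<le> s * t" using assms by (intro mult_left_mono) auto
  moreover have "s * t\<^sup>2 = w\<^sup>2 / s" using assms by (simp add: t_def power_divide power2_eq_square)
  moreover have "s * t ^ 4 = w ^ 4 / s ^ 3"
    using assms by (simp add: t_def power_divide power4_eq_xxxx power3_eq_cube)
  moreover have "s * t = \<bar>w\<bar>" using assms by (simp add: t_def)
  ultimately show ?thesis by (simp add: right_diff_distrib)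
qed

text \<open>
  The weights \<open>g\<close> are arbitrary reals here, since the moment estimates depend on them only through
  \<open>V\<close>.
\<close>

locale weighted_noise = prob_space P for P :: "'a measure" +
  fixes F :: "nat \<Rightarrow> 'a measure" and Y :: "nat \<Rightarrow> 'a \<Rightarrow> real" and g :: "nat \<Rightarrow> real"
    and M l :: real
  assumes sub: "1 \<le> n \<Longrightarrow> subalgebra P (F n)"
    and sets_mono: "1 \<le> m \<Longrightarrow> m \<le> n \<Longrightarrow> sets (F m) \<subseteq> sets (F n)"
    and Y_adapted: "1 \<le> n \<Longrightarrow> Y n \<in> borel_measurable (F n)"
    and l_pos: "0 < l"
    and Y_bounded: "1 \<le> n \<Longrightarrow> AE \<omega> in P. \<bar>Y n \<omega>\<bar> < M"
    and Y_mean: "1 \<le> n \<Longrightarrow> AE \<omega> in P. real_cond_exp P (F n) (Y (Suc n)) \<omega> = 0"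
    and Y_var: "1 \<le> n \<Longrightarrow> AE \<omega> in P. l \<le> real_cond_exp P (F n) (\<lambda>\<omega>. (Y (Suc n) \<omega>)\<^sup>2) \<omega>"
begin

definition W :: "nat \<Rightarrow> nat \<Rightarrow> 'a \<Rightarrow> real" where
  "W n N \<omega> = (\<Sum>j\<in>{n..<N}. g j * Y (Suc j) \<omega>)"

definition V :: "nat \<Rightarrow> nat \<Rightarrow> real" where
  "V n N = (\<Sum>j\<in>{n..<N}. (g j)\<^sup>2)"

text \<open>
  The constant in \<open>expectation_abs_W_ge\<close>. It comes from \<open>abs_ge_square_minus_fourth\<close> at the scale
  \<open>s = sqrt (22 * M ^ 4 / l) * sqrt (V n N)\<close>, at which the fourth-moment bound \<open>11 * M ^ 4 * (V n N)\<^sup>2 / s ^ 3\<close>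
  is half of the second-moment bound \<open>l * V n N / s\<close>.
\<close>

definition spread :: real where
  "spread = l / (2 * sqrt (22 * M ^ 4 / l))"

lemma V_nonneg: "0 \<le> V n N"
  by (simp add: V_def sum_nonneg)

lemma M_pos: "0 < M"
proof (rule ccontr)
  assume M: "\<not> 0 < M"
  from Y_bounded[OF order_refl] have "AE \<omega> in P. \<bar>Y 1 \<omega>\<bar> < 0"
    by (rule eventually_mono) (use M in linarith)
  then show False by simp
qed

lemma measurable_F_mono:
  assumes "1 \<le> m" "m \<le> n" "f \<in> borel_measurable (F m)"
  shows "f \<in> borel_measurable (F n)"
proof (rule measurable_from_subalg[OF _ assms(3)])
  show "subalgebra (F n) (F m)"
    using sets_mono[OF assms(1,2)] sub[of n] sub[of m] assms by (auto simp: subalgebra_def)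
qed

lemma measurable_F_P: "1 \<le> n \<Longrightarrow> f \<in> borel_measurable (F n) \<Longrightarrow> f \<in> borel_measurable P"
  using measurable_from_subalg[OF sub] .

lemma sets_F_P: "1 \<le> n \<Longrightarrow> A \<in> sets (F n) \<Longrightarrow> A \<in> sets P"
  using sub[of n] by (auto simp: subalgebra_def)

lemma Y_ess_bounded: "1 \<le> n \<Longrightarrow> ess_bounded P (Y n)"
  using Y_bounded[of n] measurable_F_P[OF _ Y_adapted, of n]
  by (intro ess_boundedI[where C = M]) (auto elim: eventually_mono)

lemma W_ess_bounded: "1 \<le> n \<Longrightarrow> ess_bounded P (W n N)"
  unfolding W_def by (intro ess_bounded_intros Y_ess_bounded) auto

lemma W_adapted: "1 \<le> n \<Longrightarrow> W n N \<in> borel_measurable (F N)"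
  unfolding W_def
  by (intro borel_measurable_sum borel_measurable_times borel_measurable_const
      measurable_F_mono[OF _ _ Y_adapted]) auto

lemmas bounded_integrable = ess_bounded_integrable[OF finite_measure_axioms]

lemma expectation_times_Y:
  assumes n: "1 \<le> n" and U: "ess_bounded P U" "U \<in> borel_measurable (F n)"
  shows "expectation (\<lambda>\<omega>. U \<omega> * Y (Suc n) \<omega>) = 0"
proof -
  interpret finite_measure_subalgebra P "F n" by unfold_locales (rule sub[OF n])
  have Y: "ess_bounded P (Y (Suc n))" by (rule Y_ess_bounded) simp
  have "expectation (\<lambda>\<omega>. U \<omega> * Y (Suc n) \<omega>) = expectation (\<lambda>\<omega>. U \<omega> * real_cond_exp P (F n) (Y (Suc n)) \<omega>)"
    by (rule real_cond_exp_intg(2)[symmetric])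
       (auto intro!: bounded_integrable ess_bounded_intros U Y ess_bounded_measurable[OF Y])
  also have "\<dots> = expectation (\<lambda>\<omega>. 0)"
    using Y_mean[OF n] U(1)[THEN ess_bounded_measurable] by (intro integral_cong_AE) (auto elim: eventually_mono)
  finally show ?thesis by simp
qed

lemma expectation_times_Y_square_ge:
  assumes n: "1 \<le> n" and U: "ess_bounded P U" "U \<in> borel_measurable (F n)" and U0: "\<And>\<omega>. 0 \<le> U \<omega>"
  shows "l * expectation U \<le> expectation (\<lambda>\<omega>. U \<omega> * (Y (Suc n) \<omega>)\<^sup>2)"
proof -
  interpret finite_measure_subalgebra P "F n" by unfold_locales (rule sub[OF n])
  have Y: "ess_bounded P (\<lambda>\<omega>. (Y (Suc n) \<omega>)\<^sup>2)"
    by (intro ess_bounded_intros Y_ess_bounded) simp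
  note ce = real_cond_exp_intg[OF bounded_integrable[OF ess_bounded_mult[OF U(1) Y]] U(2) ess_bounded_measurable[OF Y]]
  have "l * expectation U = expectation (\<lambda>\<omega>. U \<omega> * l)" by simp
  also have "\<dots> \<le> expectation (\<lambda>\<omega>. U \<omega> * real_cond_exp P (F n) (\<lambda>\<omega>. (Y (Suc n) \<omega>)\<^sup>2) \<omega>)"
  proof (rule integral_mono_AE)
    show "AE \<omega> in P. U \<omega> * l \<le> U \<omega> * real_cond_exp P (F n) (\<lambda>\<omega>. (Y (Suc n) \<omega>)\<^sup>2) \<omega>"
      using Y_var[OF n] by eventually_elim (rule mult_left_mono[OF _ U0])
  qed (auto intro!: bounded_integrable ess_bounded_intros U ce)
  also have "\<dots> = expectation (\<lambda>\<omega>. U \<omega> * (Y (Suc n) \<omega>)\<^sup>2)" by (rule ce)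
  finally show ?thesis .
qed

text \<open>
  In the following moment estimates \<open>G\<close> is an event known at the time \<open>n\<close> at which the accumulation
  starts. On it, powers of \<open>W n N\<close> are admissible multipliers for the next increment, so that each
  moment can be bounded by induction on \<open>N\<close>.
\<close>

context
  fixes n :: nat and G :: "'a set"
  assumes n: "1 \<le> n" and G: "G \<in> sets (F n)"
begin

lemma G_P: "G \<in> sets P"
  using sets_F_P[OF n G] .

lemma indicator_times_W_adapted:
  assumes "n \<le> N"
  shows "(\<lambda>\<omega>. indicat_real G \<omega> * W n N \<omega> ^ i) \<in> borel_measurable (F N)"
proof -
  have "indicat_real G \<in> borel_measurable (F n)" using G by simp
  then have "indicat_real G \<in> borel_measurable (F N)" by (rule measurable_F_mono[OF n assms])
  then show ?thesis using W_adapted[OF n] by (intro borel_measurable_times borel_measurable_power)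
qed

lemma indicator_times_W_bounded: "ess_bounded P (\<lambda>\<omega>. indicat_real G \<omega> * W n N \<omega> ^ i)"
  by (intro ess_bounded_intros W_ess_bounded n G_P)

lemma expectation_indicator_G: "expectation (indicat_real G) = prob G"
  using G_P by simp

lemma W_Suc: "n \<le> N \<Longrightarrow> W n (Suc N) \<omega> = W n N \<omega> + g N * Y (Suc N) \<omega>"
  by (simp add: W_def)

lemma V_Suc: "n \<le> N \<Longrightarrow> V n (Suc N) = V n N + (g N)\<^sup>2"
  by (simp add: V_def)

lemma expectation_W_power_times_Y:
  assumes "n \<le> N"
  shows "expectation (\<lambda>\<omega>. indicat_real G \<omega> * W n N \<omega> ^ i * Y (Suc N) \<omega>) = 0"
  by (intro expectation_times_Y indicator_times_W_adapted indicator_times_W_bounded)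
     (use assms n in auto)

lemma Y_Suc_ess_bounded: "ess_bounded P (Y (Suc N))"
  by (rule Y_ess_bounded) simp

lemma expectation_W: "n \<le> N \<Longrightarrow> expectation (\<lambda>\<omega>. indicat_real G \<omega> * W n N \<omega>) = 0"
proof (induction N rule: dec_induct)
  case (step N)
  have "expectation (\<lambda>\<omega>. indicat_real G \<omega> * W n (Suc N) \<omega>)
      = expectation (\<lambda>\<omega>. indicat_real G \<omega> * W n N \<omega> + g N * (indicat_real G \<omega> * W n N \<omega> ^ 0 * Y (Suc N) \<omega>))"
    using step by (simp add: W_Suc algebra_simps)
  also have "\<dots> = expectation (\<lambda>\<omega>. indicat_real G \<omega> * W n N \<omega>) + g N * expectation (\<lambda>\<omega>. indicat_real G \<omega> * W n N \<omega> ^ 0 * Y (Suc N) \<omega>)"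
    by (subst Bochner_Integration.integral_add)
       (auto simp del: power_0 intro!: bounded_integrable ess_bounded_intros W_ess_bounded n G_P Y_Suc_ess_bounded)
  finally show ?case using step expectation_W_power_times_Y[of N 0] by (simp del: power_0)
qed (simp add: W_def)

lemma expectation_W_square:
  assumes "n \<le> N"
  shows "l * V n N * prob G \<le> expectation (\<lambda>\<omega>. indicat_real G \<omega> * (W n N \<omega>)\<^sup>2)"
    and "expectation (\<lambda>\<omega>. indicat_real G \<omega> * (W n N \<omega>)\<^sup>2) \<le> M\<^sup>2 * V n N * prob G"
proof -
  have "l * V n N * prob G \<le> expectation (\<lambda>\<omega>. indicat_real G \<omega> * (W n N \<omega>)\<^sup>2)
     \<and> expectation (\<lambda>\<omega>. indicat_real G \<omega> * (W n N \<omega>)\<^sup>2) \<le> M\<^sup>2 * V n N * prob G"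
    using assms
  proof (induction N rule: dec_induct)
    case (step N)
    let ?E = "expectation (\<lambda>\<omega>. indicat_real G \<omega> * (Y (Suc N) \<omega>)\<^sup>2)"
    have "expectation (\<lambda>\<omega>. indicat_real G \<omega> * (W n (Suc N) \<omega>)\<^sup>2)
      = expectation (\<lambda>\<omega>. indicat_real G \<omega> * (W n N \<omega>)\<^sup>2 + (2 * g N) * (indicat_real G \<omega> * W n N \<omega> ^ 1 * Y (Suc N) \<omega>)
           + (g N)\<^sup>2 * (indicat_real G \<omega> * (Y (Suc N) \<omega>)\<^sup>2))"
      using step by (intro Bochner_Integration.integral_cong) (auto simp: W_Suc power2_eq_square algebra_simps)
    also have "\<dots> = expectation (\<lambda>\<omega>. indicat_real G \<omega> * (W n N \<omega>)\<^sup>2) + (2 * g N) * expectation (\<lambda>\<omega>. indicat_real G \<omega> * W n N \<omega> ^ 1 * Y (Suc N) \<omega>)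
         + (g N)\<^sup>2 * ?E"
      by (subst Bochner_Integration.integral_add
          | intro bounded_integrable ess_bounded_intros W_ess_bounded n G_P Y_Suc_ess_bounded
          | simp only: integral_mult_right_zero)+
    finally have eq: "expectation (\<lambda>\<omega>. indicat_real G \<omega> * (W n (Suc N) \<omega>)\<^sup>2)
        = expectation (\<lambda>\<omega>. indicat_real G \<omega> * (W n N \<omega>)\<^sup>2) + (g N)\<^sup>2 * ?E"
      using expectation_W_power_times_Y[of N 1] step by simp
    have "l * expectation (indicat_real G) \<le> ?E"
    proof (rule expectation_times_Y_square_ge)
      show "indicat_real G \<in> borel_measurable (F N)"
        using indicator_times_W_adapted[of N 0] step by simp
    qed (use n step G_P in \<open>auto intro: ess_bounded_intros\<close>)
    then have lower: "l * prob G \<le> ?E" by (simp only: expectation_indicator_G)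
    have "?E \<le> expectation (\<lambda>\<omega>. indicat_real G \<omega> * M\<^sup>2)"
    proof (rule integral_mono_AE)
      show "AE \<omega> in P. indicat_real G \<omega> * (Y (Suc N) \<omega>)\<^sup>2 \<le> indicat_real G \<omega> * M\<^sup>2"
        using Y_bounded[of "Suc N", simplified]
        by eventually_elim (auto simp: indicator_def intro: power2_le_iff_abs_le[THEN iffD2])
    qed (intro bounded_integrable ess_bounded_intros G_P Y_Suc_ess_bounded)+
    then have upper: "?E \<le> M\<^sup>2 * prob G" using expectation_indicator_G by (simp add: mult.commute)
    have "(g N)\<^sup>2 * (l * prob G) \<le> (g N)\<^sup>2 * ?E" "(g N)\<^sup>2 * ?E \<le> (g N)\<^sup>2 * (M\<^sup>2 * prob G)"
      using lower upper by (auto intro: mult_left_mono)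
    then show ?case using step unfolding eq by (simp add: V_Suc algebra_simps)
  qed (simp add: W_def V_def)
  then show "l * V n N * prob G \<le> expectation (\<lambda>\<omega>. indicat_real G \<omega> * (W n N \<omega>)\<^sup>2)"
    and "expectation (\<lambda>\<omega>. indicat_real G \<omega> * (W n N \<omega>)\<^sup>2) \<le> M\<^sup>2 * V n N * prob G" by auto
qed

text \<open>
  One step of the induction adds at most \<open>8 * M\<^sup>2 * (g N)\<^sup>2\<close> times the second moment plus
  \<open>3 * M ^ 4 * (g N) ^ 4\<close> times the probability of \<open>G\<close>. The second moment is
  at most \<open>M\<^sup>2 * V n N\<close> times that probability. In the square of \<open>V n N + (g N)\<^sup>2\<close> the cross term pays
  for the former as soon as the constant in front is at least \<open>4\<close>, and the last term for the latter.
\<close>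

lemma expectation_W_fourth:
  "n \<le> N \<Longrightarrow> expectation (\<lambda>\<omega>. indicat_real G \<omega> * W n N \<omega> ^ 4) \<le> 11 * M ^ 4 * (V n N)\<^sup>2 * prob G"
proof (induction N rule: dec_induct)
  case (step N)
  define b where "b = M\<^sup>2 * (g N)\<^sup>2"
  have b: "0 \<le> b" by (simp add: b_def)
  have "expectation (\<lambda>\<omega>. indicat_real G \<omega> * W n (Suc N) \<omega> ^ 4)
    \<le> expectation (\<lambda>\<omega>. indicat_real G \<omega> * W n N \<omega> ^ 4 + (4 * g N) * (indicat_real G \<omega> * W n N \<omega> ^ 3 * Y (Suc N) \<omega>)
         + (8 * b) * (indicat_real G \<omega> * (W n N \<omega>)\<^sup>2) + (3 * b\<^sup>2) * indicat_real G \<omega>)"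
  proof (rule integral_mono_AE)
    show "AE \<omega> in P. indicat_real G \<omega> * W n (Suc N) \<omega> ^ 4 \<le> indicat_real G \<omega> * W n N \<omega> ^ 4 + (4 * g N) * (indicat_real G \<omega> * W n N \<omega> ^ 3 * Y (Suc N) \<omega>)
         + (8 * b) * (indicat_real G \<omega> * (W n N \<omega>)\<^sup>2) + (3 * b\<^sup>2) * indicat_real G \<omega>"
      using Y_bounded[of "Suc N", simplified]
    proof eventually_elim
      case (elim \<omega>)
      then have "(Y (Suc N) \<omega>)\<^sup>2 \<le> M\<^sup>2" by (intro power2_le_iff_abs_le[THEN iffD2]) auto
      then have "(g N * Y (Suc N) \<omega>)\<^sup>2 \<le> b"
        by (simp add: b_def power_mult_distrib mult.commute[of "M\<^sup>2"] mult_left_mono)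
      from fourth_power_add_le[OF this, of "W n N \<omega>"] show ?case
        using step by (auto simp: W_Suc indicator_def mult_ac)
    qed
  qed (intro bounded_integrable ess_bounded_intros W_ess_bounded n G_P Y_Suc_ess_bounded)+
  also have "\<dots> = expectation (\<lambda>\<omega>. indicat_real G \<omega> * W n N \<omega> ^ 4) + (4 * g N) * expectation (\<lambda>\<omega>. indicat_real G \<omega> * W n N \<omega> ^ 3 * Y (Suc N) \<omega>)
         + (8 * b) * expectation (\<lambda>\<omega>. indicat_real G \<omega> * (W n N \<omega>)\<^sup>2) + (3 * b\<^sup>2) * expectation (indicat_real G)"
    by (subst Bochner_Integration.integral_add
        | intro bounded_integrable ess_bounded_intros W_ess_bounded n G_P Y_Suc_ess_bounded
        | simp only: integral_mult_right_zero)+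
  also have "\<dots> = expectation (\<lambda>\<omega>. indicat_real G \<omega> * W n N \<omega> ^ 4)
         + (8 * b) * expectation (\<lambda>\<omega>. indicat_real G \<omega> * (W n N \<omega>)\<^sup>2) + (3 * b\<^sup>2) * prob G"
    using expectation_W_power_times_Y[of N 3] step expectation_indicator_G by simp
  also have "\<dots> \<le> 11 * M ^ 4 * (V n N)\<^sup>2 * prob G + (8 * b) * (M\<^sup>2 * V n N * prob G) + (3 * b\<^sup>2) * prob G"
    using step b by (intro add_mono mult_left_mono expectation_W_square order_refl) auto
  also have "\<dots> = M ^ 4 * prob G * (11 * (V n N)\<^sup>2 + 8 * V n N * (g N)\<^sup>2 + 3 * ((g N)\<^sup>2)\<^sup>2)"
    unfolding b_def by algebra
  also have "\<dots> \<le> M ^ 4 * prob G * (11 * (V n N + (g N)\<^sup>2)\<^sup>2)"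
  proof (rule mult_left_mono)
    have "0 \<le> V n N * (g N)\<^sup>2" "0 \<le> ((g N)\<^sup>2)\<^sup>2" using V_nonneg[of n N] by auto
    then show "11 * (V n N)\<^sup>2 + 8 * V n N * (g N)\<^sup>2 + 3 * ((g N)\<^sup>2)\<^sup>2 \<le> 11 * (V n N + (g N)\<^sup>2)\<^sup>2"
      by (simp add: power2_sum distrib_left mult.assoc)
  qed simp
  finally show ?case using step by (simp add: V_Suc mult_ac)
qed (simp add: W_def V_def)

lemma expectation_abs_W_ge:
  assumes N: "n \<le> N"
  shows "spread * sqrt (V n N) * prob G \<le> expectation (\<lambda>\<omega>. indicat_real G \<omega> * \<bar>W n N \<omega>\<bar>)"
proof (cases "V n N = 0")
  case False
  then have V: "0 < V n N" using V_nonneg[of n N] by simp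
  define \<sigma> where "\<sigma> = sqrt (22 * M ^ 4 / l)"
  have \<sigma>: "0 < \<sigma>" "\<sigma>\<^sup>2 = 22 * M ^ 4 / l" using M_pos l_pos by (auto simp: \<sigma>_def)
  define s where "s = \<sigma> * sqrt (V n N)"
  have s: "0 < s" using \<sigma> V by (simp add: s_def)
  have s2: "l * s\<^sup>2 = 22 * M ^ 4 * V n N" using \<sigma> V l_pos by (simp add: s_def power_mult_distrib)
  have "s * sqrt (V n N) = \<sigma> * V n N" using V by (simp add: s_def)
  then have "spread * sqrt (V n N) = l * V n N / (2 * s)"
    using s \<sigma> V by (simp add: spread_def \<sigma>_def[symmetric] field_simps)
  also have "\<dots> = l * V n N / s - 11 * M ^ 4 * (V n N)\<^sup>2 / s ^ 3"
  proof -
    have "11 * M ^ 4 * (V n N)\<^sup>2 = l * s\<^sup>2 * V n N / 2" unfolding s2 by (simp add: power2_eq_square)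
    then show ?thesis using s by (simp add: power2_eq_square power3_eq_cube field_simps)
  qed
  finally have "spread * sqrt (V n N) * prob G = (l * V n N * prob G) / s - (11 * M ^ 4 * (V n N)\<^sup>2 * prob G) / s ^ 3"
    by (simp add: left_diff_distrib)
  also have "\<dots> \<le> expectation (\<lambda>\<omega>. indicat_real G \<omega> * (W n N \<omega>)\<^sup>2) / s
      - expectation (\<lambda>\<omega>. indicat_real G \<omega> * W n N \<omega> ^ 4) / s ^ 3"
    using s expectation_W_square(1)[OF N] expectation_W_fourth[OF N]
    by (intro diff_mono divide_right_mono) auto
  also have "\<dots> = expectation (\<lambda>\<omega>. indicat_real G \<omega> * (W n N \<omega>)\<^sup>2 / s - indicat_real G \<omega> * W n N \<omega> ^ 4 / s ^ 3)"
    by (subst Bochner_Integration.integral_diff)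
       (auto intro!: bounded_integrable ess_bounded_intros W_ess_bounded n G_P)
  also have "\<dots> \<le> expectation (\<lambda>\<omega>. indicat_real G \<omega> * \<bar>W n N \<omega>\<bar>)"
  proof (rule integral_mono)
    fix \<omega>
    show "indicat_real G \<omega> * (W n N \<omega>)\<^sup>2 / s - indicat_real G \<omega> * W n N \<omega> ^ 4 / s ^ 3 \<le> indicat_real G \<omega> * \<bar>W n N \<omega>\<bar>"
      using abs_ge_square_minus_fourth[OF s, of "W n N \<omega>"] by (simp add: indicator_def)
  qed (intro Bochner_Integration.integrable_diff bounded_integrable ess_bounded_intros W_ess_bounded n G_P)+
  finally show ?thesis .
qed simp

end

text \<open>
  This is the Cauchy-Schwarz inequality for the indicator of \<open>D\<close> and \<open>W n N\<close>, in the form of a weighted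
  inequality of arithmetic and geometric means. In contrast to the estimates above, \<open>D\<close> may
  depend on the whole future.
\<close>

lemma expectation_abs_W_on_small_set:
  assumes n: "1 \<le> n" and N: "n \<le> N" and D: "D \<in> sets P" and \<theta>: "0 < \<theta>" and small: "prob D \<le> \<theta>\<^sup>2"
  shows "expectation (\<lambda>\<omega>. indicat_real D \<omega> * \<bar>W n N \<omega>\<bar>) \<le> \<theta> * M * sqrt (V n N)"
proof (cases "V n N = 0")
  case True
  then have "\<forall>j\<in>{n..<N}. g j = 0" by (simp add: V_def sum_nonneg_eq_0_iff)
  then have "W n N \<omega> = 0" for \<omega> by (simp add: W_def)
  then show ?thesis using True by simp
next
  case False
  define s where "s = M * sqrt (V n N)"
  have s: "0 < s" using False V_nonneg[of n N] M_pos by (simp add: s_def)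
  have sp: "space P = space (F n)" using sub[OF n] by (simp add: subalgebra_def)
  have W2: "expectation (\<lambda>\<omega>. (W n N \<omega>)\<^sup>2) \<le> s\<^sup>2"
  proof -
    have "expectation (\<lambda>\<omega>. (W n N \<omega>)\<^sup>2) = expectation (\<lambda>\<omega>. indicat_real (space P) \<omega> * (W n N \<omega>)\<^sup>2)"
      by (intro Bochner_Integration.integral_cong) auto
    also have "\<dots> \<le> M\<^sup>2 * V n N * prob (space P)"
      by (rule expectation_W_square(2)[OF n _ N]) (simp add: sp)
    finally show ?thesis using V_nonneg[of n N] by (simp add: prob_space s_def power_mult_distrib)
  qed
  have "expectation (\<lambda>\<omega>. indicat_real D \<omega> * \<bar>W n N \<omega>\<bar>)
     \<le> expectation (\<lambda>\<omega>. \<theta> / (2 * s) * (W n N \<omega>)\<^sup>2 + s / (2 * \<theta>) * indicat_real D \<omega>)"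
  proof (rule integral_mono)
    fix \<omega>
    have "0 \<le> (\<theta> * \<bar>W n N \<omega>\<bar> - s)\<^sup>2 / (2 * \<theta> * s)" using \<theta> s by simp
    also have "\<dots> = \<theta> / (2 * s) * (W n N \<omega>)\<^sup>2 + s / (2 * \<theta>) - \<bar>W n N \<omega>\<bar>"
      using \<theta> s by (simp add: power2_eq_square field_simps)
    finally show "indicat_real D \<omega> * \<bar>W n N \<omega>\<bar> \<le> \<theta> / (2 * s) * (W n N \<omega>)\<^sup>2 + s / (2 * \<theta>) * indicat_real D \<omega>"
      using \<theta> s by (simp add: indicator_def)
  qed (intro bounded_integrable ess_bounded_intros W_ess_bounded n D)+
  also have "\<dots> = \<theta> / (2 * s) * expectation (\<lambda>\<omega>. (W n N \<omega>)\<^sup>2) + s / (2 * \<theta>) * prob D"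
    using D by (subst Bochner_Integration.integral_add)
       (auto intro!: bounded_integrable ess_bounded_intros W_ess_bounded n)
  also have "\<dots> \<le> \<theta> / (2 * s) * s\<^sup>2 + s / (2 * \<theta>) * \<theta>\<^sup>2"
    using W2 small \<theta> s by (intro add_mono mult_left_mono) auto
  also have "\<dots> = \<theta> * s" using \<theta> s by (simp add: power2_eq_square)
  finally show ?thesis by (simp add: s_def mult.assoc)
qed

end

section \<open>Confinement near the repelling point has probability zero\<close>

context weighted_noise
begin

text \<open>
  The inequality \<open>2 * (a n + a N) \<ge> (sum of g j * a j powr k)\<close> arises by adding the two consequences of
  the recursion summed on the confinement event \<open>B\<close>: the loss \<open>\<kappa> * sqrt (V n N)\<close> caused by \<open>B\<close> not being known at time
  \<open>n\<close> is itself at most \<open>a n + a N\<close>. This is why \<open>\<kappa>\<close> is chosen to serve in both places.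
\<close>

lemma confined_paths_null:
  fixes X :: "nat \<Rightarrow> 'a \<Rightarrow> real" and \<gamma> k \<epsilon> :: real and n0 :: nat
  assumes gamma: "1/2 < \<gamma>" "\<gamma> < 1" and k: "1 < k" and gk: "\<gamma> < 1/2 + 1/(2*k)"
    and g: "\<And>j. g j = real j powr - \<gamma>"
    and X_adapted: "\<And>n. 1 \<le> n \<Longrightarrow> X n \<in> borel_measurable (F n)"
    and n0: "1 \<le> n0" and \<epsilon>: "0 < \<epsilon>"
    and step: "\<And>n. 1 \<le> n \<Longrightarrow> AE \<omega> in P. \<bar>X n \<omega>\<bar> \<le> \<epsilon> \<longrightarrow>
       X n \<omega> + g n * \<bar>X n \<omega>\<bar> powr k + g n * Y (Suc n) \<omega> \<le> X (Suc n) \<omega>"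
  shows "{\<omega> \<in> space P. \<forall>m\<ge>n0. \<bar>X m \<omega>\<bar> \<le> \<epsilon>} \<in> null_sets P"
proof -
  define B where "B = {\<omega> \<in> space P. \<forall>m\<ge>n0. \<bar>X m \<omega>\<bar> \<le> \<epsilon>}"
  define Bn where "Bn n = {\<omega> \<in> space P. \<forall>m\<in>{n0..n}. \<bar>X m \<omega>\<bar> \<le> \<epsilon>}" for n
  define D where "D n = Bn n - B" for n
  have XP: "X n \<in> borel_measurable P" if "n0 \<le> n" for n
    using that n0 by (intro measurable_F_P[OF _ X_adapted]) auto
  have Bn_F: "Bn n \<in> sets (F n)" if n: "n0 \<le> n" for n
  proof -
    have sp: "space P = space (F n)" using sub[of n] n n0 by (simp add: subalgebra_def)
    have [measurable]: "X m \<in> borel_measurable (F n)" if "m \<in> {n0..n}" for m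
      using that n0 by (intro measurable_F_mono[OF _ _ X_adapted]) auto
    show ?thesis unfolding Bn_def sp by measurable
  qed
  have Bn_P: "Bn n \<in> sets P" if n: "n0 \<le> n" for n
    using sets_F_P[OF _ Bn_F[OF n]] n n0 by simp
  have B_eq: "B = (\<Inter>i. Bn (n0 + i))"
  proof (intro equalityI subsetI)
    fix \<omega> assume *: "\<omega> \<in> (\<Inter>i. Bn (n0 + i))"
    have "\<bar>X m \<omega>\<bar> \<le> \<epsilon>" if "n0 \<le> m" for m
    proof -
      have "\<omega> \<in> Bn (n0 + (m - n0))" using * by blast
      then show ?thesis using that by (auto simp: Bn_def)
    qed
    moreover have "\<omega> \<in> space P" using * by (auto simp: Bn_def)
    ultimately show "\<omega> \<in> B" by (simp add: B_def)
  qed (auto simp: B_def Bn_def)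
  have B_P: "B \<in> sets P" unfolding B_eq by (rule sets.countable_INT') (auto intro: Bn_P)
  have D_P: "D n \<in> sets P" if n: "n0 \<le> n" for n
    unfolding D_def using Bn_P[OF n] B_P by blast
  have B_sub: "B \<subseteq> Bn n" for n by (auto simp: B_def Bn_def)
  have "decseq (\<lambda>i. Bn (n0 + i))" by (rule decseq_SucI) (auto simp: Bn_def)
  then have "(\<lambda>i. prob (Bn (n0 + i))) \<longlonglongrightarrow> prob (\<Inter>i. Bn (n0 + i))"
    by (intro finite_Lim_measure_decseq) (auto intro: Bn_P)
  then have "(\<lambda>i. prob (Bn (i + n0))) \<longlonglongrightarrow> prob B"
    by (simp add: B_eq add.commute)
  then have Bn_lim: "(\<lambda>n. prob (Bn n)) \<longlonglongrightarrow> prob B" by (rule LIMSEQ_offset)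
  have prob_D: "prob (D n) = prob (Bn n) - prob B" if "n0 \<le> n" for n
    unfolding D_def using Bn_P[OF that] B_P B_sub by (intro finite_measure_Diff) auto

  have "prob B = 0"
  proof (rule ccontr)
    assume "prob B \<noteq> 0"
    then have p: "0 < prob B" using measure_nonneg[of P B] by linarith
    \<comment> \<open>On \<open>Bn n\<close> the positive part of \<open>W n N\<close> has mean at least \<open>prob B * spread / 2 = 2 * \<kappa>\<close> times
        \<open>sqrt (V n N)\<close>; at most \<open>\<kappa> * sqrt (V n N)\<close> of it is lost in passing from \<open>Bn n\<close> to \<open>B\<close>.\<close>
    define \<kappa> where "\<kappa> = prob B * spread / 4"
    have spread: "0 < spread" using M_pos l_pos by (simp add: spread_def)
    have \<kappa>: "0 < \<kappa>" using p spread by (simp add: \<kappa>_def)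
    define \<theta> where "\<theta> = \<kappa> / M"
    have \<theta>: "0 < \<theta>" "\<theta> * M = \<kappa>" using \<kappa> M_pos by (auto simp: \<theta>_def)
    have "eventually (\<lambda>n. prob (Bn n) < prob B + \<theta>\<^sup>2) sequentially"
      using \<theta> by (intro order_tendstoD(2)[OF Bn_lim]) simp
    then obtain n1' where n1': "\<And>n. n1' \<le> n \<Longrightarrow> prob (Bn n) < prob B + \<theta>\<^sup>2"
      by (auto simp: eventually_sequentially)
    define n1 where "n1 = max n0 n1'"
    have n1: "n1 \<le> n \<Longrightarrow> n0 \<le> n" "n1 \<le> n \<Longrightarrow> 1 \<le> n" for n using n0 by (auto simp: n1_def)
    have W_small: "expectation (\<lambda>\<omega>. indicat_real (D n) \<omega> * \<bar>W n N \<omega>\<bar>) \<le> \<kappa> * sqrt (V n N)"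
      if n: "n1 \<le> n" and N: "n \<le> N" for n N
    proof -
      have "n1' \<le> n" using n by (simp add: n1_def)
      then have "prob (D n) \<le> \<theta>\<^sup>2" using n1' prob_D n1(1)[OF n] by fastforce
      from expectation_abs_W_on_small_set[OF n1(2)[OF n] N D_P[OF n1(1)[OF n]] \<theta>(1) this]
      show ?thesis by (simp add: \<theta>(2))
    qed
    define I where "I = indicat_real B"
    have I_bdd: "ess_bounded P I" unfolding I_def by (intro ess_bounded_intros B_P)
    \<comment> \<open>Named constants keep the search for boundedness proofs from splitting these products
        into \<open>I\<close> and the unbounded \<open>X n\<close>.\<close>
    define Z where "Z n \<omega> = I \<omega> * \<bar>X n \<omega>\<bar>" for n \<omega>
    define H where "H n \<omega> = I \<omega> * \<bar>X n \<omega>\<bar> powr k" for n \<omega>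
    have Z_le: "0 \<le> Z n \<omega>" "Z n \<omega> \<le> \<epsilon>" if "n0 \<le> n" for n \<omega>
      using that \<epsilon> by (auto simp: Z_def I_def B_def indicator_def)
    have Z_bdd: "ess_bounded P (Z n)" if n: "n0 \<le> n" for n
    proof (rule ess_boundedI[where C = \<epsilon>])
      show "Z n \<in> borel_measurable P"
        unfolding Z_def[abs_def] I_def using B_P XP[OF n] by measurable
      show "AE \<omega> in P. \<bar>Z n \<omega>\<bar> \<le> \<epsilon>" using Z_le[OF n] by simp
    qed
    have H_bdd: "ess_bounded P (H n)" if n: "n0 \<le> n" for n
    proof (rule ess_boundedI[where C = "\<epsilon> powr k"])
      show "H n \<in> borel_measurable P"
        unfolding H_def[abs_def] I_def using B_P XP[OF n] by measurable
      have "\<bar>H n \<omega>\<bar> \<le> \<epsilon> powr k" for \<omega>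
        using n k by (auto simp: H_def I_def B_def indicator_def intro!: powr_mono2)
      then show "AE \<omega> in P. \<bar>H n \<omega>\<bar> \<le> \<epsilon> powr k" by simp
    qed
    have I_int: "expectation I = prob B" using B_P by (simp add: I_def)
    define a where "a n = expectation (Z n)" for n
    have a0: "0 \<le> a n" for n
      unfolding a_def by (rule integral_nonneg_AE) (simp add: Z_def I_def)
    have a_le: "a n \<le> \<epsilon>" if "n0 \<le> n" for n
    proof -
      have "a n \<le> expectation (\<lambda>\<omega>. \<epsilon>)" unfolding a_def
        using that Z_le by (intro integral_mono bounded_integrable ess_bounded_const Z_bdd) auto
      then show ?thesis by (simp add: prob_space)
    qed
    have a_powr: "a n powr k \<le> expectation (H n)" if n: "n0 \<le> n" for n
    proof -
      \<comment> \<open>The tangent at \<open>a n\<close>, integrated over \<open>B\<close>, exceeds \<open>a n powr k\<close> by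
          \<open>(k - 1) * (1 - prob B) * a n powr k\<close>, so the missing mass helps.\<close>
      let ?d = "k * a n powr (k - 1)"
      have "0 \<le> (k - 1) * (1 - prob B) * a n powr k" using k by simp
      moreover have "a n powr (k - 1) * a n = a n powr k"
        using a0[of n] k by (cases "a n = 0") (auto simp: powr_mult_base mult.commute)
      then have "(a n powr k - ?d * a n) * prob B + ?d * a n = a n powr k + (k - 1) * (1 - prob B) * a n powr k"
        by (simp add: algebra_simps)
      ultimately have "a n powr k \<le> (a n powr k - ?d * a n) * prob B + ?d * a n" by linarith
      also have "\<dots> = expectation (\<lambda>\<omega>. (a n powr k - ?d * a n) * I \<omega> + ?d * Z n \<omega>)"
        unfolding a_def I_int[symmetric]
        by (subst Bochner_Integration.integral_add
            | intro bounded_integrable ess_bounded_intros I_bdd Z_bdd n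
            | simp only: integral_mult_right_zero)+
      also have "\<dots> \<le> expectation (H n)"
      proof (rule integral_mono)
        fix \<omega>
        show "(a n powr k - ?d * a n) * I \<omega> + ?d * Z n \<omega> \<le> H n \<omega>"
          using powr_tangent_le[OF k abs_ge_zero a0, of n "X n \<omega>"]
          by (simp add: Z_def H_def I_def indicator_def algebra_simps)
      qed (intro bounded_integrable ess_bounded_intros I_bdd Z_bdd H_bdd n)+
      finally show ?thesis .
    qed
    have "AE \<omega> in P. \<forall>n. 1 \<le> n \<longrightarrow> \<bar>X n \<omega>\<bar> \<le> \<epsilon> \<longrightarrow>
       X n \<omega> + g n * \<bar>X n \<omega>\<bar> powr k + g n * Y (Suc n) \<omega> \<le> X (Suc n) \<omega>"
      unfolding AE_all_countable using step by auto
    then have path: "AE \<omega> in P. \<forall>n N. \<omega> \<in> B \<longrightarrow> n0 \<le> n \<longrightarrow> n \<le> N \<longrightarrow>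
       X n \<omega> + (\<Sum>j\<in>{n..<N}. g j * \<bar>X j \<omega>\<bar> powr k) + W n N \<omega> \<le> X N \<omega>"
    proof (eventually_elim, intro allI impI)
      fix \<omega> n N
      assume st: "\<forall>n. 1 \<le> n \<longrightarrow> \<bar>X n \<omega>\<bar> \<le> \<epsilon> \<longrightarrow>
        X n \<omega> + g n * \<bar>X n \<omega>\<bar> powr k + g n * Y (Suc n) \<omega> \<le> X (Suc n) \<omega>"
        and B: "\<omega> \<in> B" and n: "n0 \<le> n" and N: "n \<le> N"
      show "X n \<omega> + (\<Sum>j\<in>{n..<N}. g j * \<bar>X j \<omega>\<bar> powr k) + W n N \<omega> \<le> X N \<omega>"
        using N
      proof (induction N rule: dec_induct)
        case (step N)
        have "\<bar>X N \<omega>\<bar> \<le> \<epsilon>" using B n step by (simp add: B_def)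
        then show ?case using st[rule_format, of N] step n n0 by (simp add: W_def)
      qed (simp add: W_def)
    qed
    have noise: "\<kappa> * sqrt (V n N) \<le> a n + a N" if n: "n1 \<le> n" and N: "n \<le> N" for n N
    proof -
      have n': "n0 \<le> n" "1 \<le> n" "n0 \<le> N" using n1[OF n] N by auto
      note bi = bounded_integrable ess_bounded_intros Z_bdd W_ess_bounded n' Bn_P D_P
      let ?EB = "\<lambda>U. expectation (\<lambda>\<omega>. indicat_real (Bn n) \<omega> * U \<omega>)"
      let ?ED = "\<lambda>U. expectation (\<lambda>\<omega>. indicat_real (D n) \<omega> * U \<omega>)"
      have "4 * \<kappa> * sqrt (V n N) = spread * sqrt (V n N) * prob B" by (simp add: \<kappa>_def)
      also have "\<dots> \<le> spread * sqrt (V n N) * prob (Bn n)"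
        using spread V_nonneg[of n N] Bn_P[OF n'(1)] B_sub[of n] by (intro mult_left_mono finite_measure_mono) auto
      also have "\<dots> \<le> ?EB (\<lambda>\<omega>. \<bar>W n N \<omega>\<bar>)"
        by (rule expectation_abs_W_ge[OF n'(2) Bn_F[OF n'(1)] N])
      \<comment> \<open>The positive part of \<open>W\<close> is \<open>(\<bar>W\<bar> + W) / 2\<close>, and on \<open>B\<close> it is at most \<open>\<bar>X n\<bar> + \<bar>X N\<bar>\<close>.
          On \<open>Bn n - B\<close>, where nothing is known about \<open>X\<close> after time \<open>n\<close>, it is at most \<open>\<bar>W\<bar>\<close>.\<close>
      finally have "4 * \<kappa> * sqrt (V n N) / 2 - \<kappa> * sqrt (V n N)
          \<le> ?EB (\<lambda>\<omega>. \<bar>W n N \<omega>\<bar>) / 2 + ?EB (W n N) / 2 - ?ED (\<lambda>\<omega>. \<bar>W n N \<omega>\<bar>)"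
        using W_small[OF n N] expectation_W[OF n'(2) Bn_F[OF n'(1)] N] by simp
      also have "\<dots> = expectation (\<lambda>\<omega>. indicat_real (Bn n) \<omega> * \<bar>W n N \<omega>\<bar> / 2
          + indicat_real (Bn n) \<omega> * W n N \<omega> / 2 + (- 1) * (indicat_real (D n) \<omega> * \<bar>W n N \<omega>\<bar>))"
        by (subst Bochner_Integration.integral_add
            | intro bi | simp only: integral_mult_right_zero integral_divide_zero)+
      also have "\<dots> \<le> expectation (\<lambda>\<omega>. Z n \<omega> + Z N \<omega>)"
      proof (rule integral_mono_AE)
        show "AE \<omega> in P. indicat_real (Bn n) \<omega> * \<bar>W n N \<omega>\<bar> / 2 + indicat_real (Bn n) \<omega> * W n N \<omega> / 2
            + (- 1) * (indicat_real (D n) \<omega> * \<bar>W n N \<omega>\<bar>) \<le> Z n \<omega> + Z N \<omega>"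
          using path
        proof eventually_elim
          case (elim \<omega>)
          show ?case
          proof (cases "\<omega> \<in> B")
            case True
            have "0 \<le> (\<Sum>j\<in>{n..<N}. g j * \<bar>X j \<omega>\<bar> powr k)" by (intro sum_nonneg) (simp add: g)
            moreover have "X n \<omega> + (\<Sum>j\<in>{n..<N}. g j * \<bar>X j \<omega>\<bar> powr k) + W n N \<omega> \<le> X N \<omega>"
              using elim True n' N by blast
            moreover have "\<omega> \<in> Bn n" "\<omega> \<notin> D n" using True B_sub by (auto simp: D_def)
            ultimately show ?thesis using True by (simp add: I_def Z_def H_def)
          next
            case False
            then show ?thesis by (auto simp: Z_def H_def I_def D_def indicator_def)
          qed
        qed
      qed (intro bi)+
      also have "\<dots> = a n + a N"
        unfolding a_def by (rule Bochner_Integration.integral_add) (intro bi)+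
      finally show ?thesis by simp
    qed
    have drift: "(\<Sum>j\<in>{n..<N}. g j * a j powr k) \<le> 2 * (a n + a N)" if n: "n1 \<le> n" and N: "n \<le> N" for n N
    proof -
      have n': "n0 \<le> n" "1 \<le> n" "n0 \<le> N" using n1[OF n] N by auto
      note bi = bounded_integrable ess_bounded_intros Z_bdd H_bdd W_ess_bounded n' Bn_P D_P
      let ?ED = "\<lambda>U. expectation (\<lambda>\<omega>. indicat_real (D n) \<omega> * U \<omega>)"
      have "(\<Sum>j\<in>{n..<N}. g j * a j powr k) \<le> (\<Sum>j\<in>{n..<N}. g j * expectation (H j))"
        using n' by (intro sum_mono mult_left_mono a_powr) (auto simp: g)
      also have "\<dots> = expectation (\<lambda>\<omega>. \<Sum>j\<in>{n..<N}. g j * H j \<omega>)"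
        using n' by (subst Bochner_Integration.integral_sum) (auto intro!: bi)
      also have "\<dots> \<le> expectation (\<lambda>\<omega>. Z n \<omega> + Z N \<omega>
          + (- 1) * (indicat_real (Bn n) \<omega> * W n N \<omega>) + indicat_real (D n) \<omega> * \<bar>W n N \<omega>\<bar>)"
      proof (rule integral_mono_AE)
        show "AE \<omega> in P. (\<Sum>j\<in>{n..<N}. g j * H j \<omega>) \<le> Z n \<omega> + Z N \<omega>
          + (- 1) * (indicat_real (Bn n) \<omega> * W n N \<omega>) + indicat_real (D n) \<omega> * \<bar>W n N \<omega>\<bar>"
          using path
        proof eventually_elim
          case (elim \<omega>)
          show ?case
          proof (cases "\<omega> \<in> B")
            case True
            have "X n \<omega> + (\<Sum>j\<in>{n..<N}. g j * \<bar>X j \<omega>\<bar> powr k) + W n N \<omega> \<le> X N \<omega>"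
              using elim True n' N by blast
            moreover have "\<omega> \<in> Bn n" "\<omega> \<notin> D n" using True B_sub by (auto simp: D_def)
            ultimately show ?thesis using True by (simp add: I_def Z_def H_def)
          next
            case False
            then show ?thesis by (auto simp: Z_def H_def I_def D_def indicator_def)
          qed
        qed
        show "integrable P (\<lambda>\<omega>. \<Sum>j\<in>{n..<N}. g j * H j \<omega>)"
          using n' by (auto intro!: bi)
      qed (intro bi)+
      also have "\<dots> = a n + a N + (- 1) * expectation (\<lambda>\<omega>. indicat_real (Bn n) \<omega> * W n N \<omega>) + ?ED (\<lambda>\<omega>. \<bar>W n N \<omega>\<bar>)"
        unfolding a_def
        by (subst Bochner_Integration.integral_add
            | intro bi | simp only: integral_mult_right_zero)+
      also have "\<dots> \<le> a n + a N + \<kappa> * sqrt (V n N)"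
        using W_small[OF n N] expectation_W[OF n'(2) Bn_F[OF n'(1)] N] by simp
      also have "\<dots> \<le> 2 * (a n + a N)" using noise[OF n N] by simp
      finally show ?thesis .
    qed
    have "1 \<le> n1" using n1(2) by blast
    then show False
    proof (rule drift_and_noise_bounds_incompatible[OF gamma k gk _ \<kappa> a0])
      show "a n \<le> \<epsilon>" if "n1 \<le> n" for n using a_le n1(1)[OF that] .
      show "\<kappa> * sqrt (\<Sum>j\<in>{n..<N}. (real j powr - \<gamma>)\<^sup>2) \<le> a n + a N"
        if "n1 \<le> n" "n \<le> N" for n N
        using noise[OF that] by (simp add: V_def g)
      show "(\<Sum>j\<in>{n..<N}. real j powr - \<gamma> * a j powr k) \<le> 2 * (a n + a N)"
        if "n1 \<le> n" "n \<le> N" for n N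
        using drift[OF that] by (simp add: g)
    qed
  qed
  then show ?thesis using B_P by (auto simp: B_def[symmetric] null_sets_def emeasure_eq_measure)
qed

end

section \<open>Non-convergence to the repelling point\<close>

theorem theorem1p3:
  fixes P :: "'a measure"
    and F :: "nat \<Rightarrow> 'a measure"
    and X Y :: "nat \<Rightarrow> 'a \<Rightarrow> real"
    and f :: "real \<Rightarrow> real"
    and N :: "real set"
    and \<gamma> k M l :: real
  assumes gamma: "\<gamma> \<in> {1/2<..<1}"
    and k: "k \<in> {1<..}"
    and gamma_k: "1/2 + 1/(2*k) > \<gamma>"
    and N: "0 \<in> interior N"
    and f: "\<And>x. x \<in> N \<Longrightarrow> \<bar>x\<bar> powr k \<le> f x"
    and P: "prob_space P"
    and sub: "\<And>n. n \<ge> 1 \<Longrightarrow> subalgebra P (F n)"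
    and filt: "filtration (space P) (\<lambda>n. F (Suc n))"
    and X_adapted: "\<And>n. n \<ge> 1 \<Longrightarrow> X n \<in> borel_measurable (F n)"
    and Y_adapted: "\<And>n. n \<ge> 1 \<Longrightarrow> Y n \<in> borel_measurable (F n)"
    and step: "\<And>n. n \<ge> 1 \<Longrightarrow> AE \<omega> in P.
        X (n + 1) \<omega> - X n \<omega> \<ge> f (X n \<omega>) / real n powr \<gamma> + Y (n + 1) \<omega> / real n powr \<gamma>"
    and l: "l > 0"
    and Y_bounded: "\<And>n. n \<ge> 1 \<Longrightarrow> AE \<omega> in P. \<bar>Y n \<omega>\<bar> < M"
    and Y_mean: "\<And>n. n \<ge> 1 \<Longrightarrow> AE \<omega> in P. real_cond_exp P (F n) (Y (n + 1)) \<omega> = 0"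
    and Y_var: "\<And>n. n \<ge> 1 \<Longrightarrow>
        AE \<omega> in P. real_cond_exp P (F n) (\<lambda>\<omega>. (Y (n + 1) \<omega>)\<^sup>2) \<omega> \<ge> l"
  shows "measure P {\<omega> \<in> space P. (\<lambda>n. X n \<omega>) \<longlonglongrightarrow> 0} = 0"
proof -
  interpret prob_space P by (rule P)
  interpret weighted_noise P F Y "\<lambda>j. real j powr - \<gamma>" M l
  proof unfold_locales
    fix m n :: nat assume "1 \<le> m" "m \<le> n"
    then show "sets (F m) \<subseteq> sets (F n)"
      using filtration.sets_F_mono[OF filt, of "m - 1" "n - 1"] by simp
  qed (use sub Y_adapted l Y_bounded Y_mean Y_var in auto)
  obtain \<epsilon> where \<epsilon>: "0 < \<epsilon>" "cball 0 \<epsilon> \<subseteq> N" using N mem_interior_cball by blast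
  define B where "B n = {\<omega> \<in> space P. \<forall>m\<ge>n. \<bar>X m \<omega>\<bar> \<le> \<epsilon>}" for n
  \<comment> \<open>The successor: adaptedness starts at time \<open>1\<close>.\<close>
  have "B (Suc n) \<in> null_sets P" for n
    unfolding B_def
  proof (rule confined_paths_null[OF _ _ _ gamma_k refl X_adapted])
    fix n :: nat assume n: "1 \<le> n"
    show "AE \<omega> in P. \<bar>X n \<omega>\<bar> \<le> \<epsilon> \<longrightarrow>
      X n \<omega> + real n powr - \<gamma> * \<bar>X n \<omega>\<bar> powr k + real n powr - \<gamma> * Y (Suc n) \<omega> \<le> X (Suc n) \<omega>"
      using step[OF n]
    proof (eventually_elim, intro impI)
      fix \<omega> assume st: "f (X n \<omega>) / real n powr \<gamma> + Y (n + 1) \<omega> / real n powr \<gamma> \<le> X (n + 1) \<omega> - X n \<omega>"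
        and "\<bar>X n \<omega>\<bar> \<le> \<epsilon>"
      then have "\<bar>X n \<omega>\<bar> powr k \<le> f (X n \<omega>)" using \<epsilon> by (intro f) (auto simp: dist_real_def)
      then have "\<bar>X n \<omega>\<bar> powr k / real n powr \<gamma> \<le> f (X n \<omega>) / real n powr \<gamma>"
        by (intro divide_right_mono) auto
      with st show "X n \<omega> + real n powr - \<gamma> * \<bar>X n \<omega>\<bar> powr k + real n powr - \<gamma> * Y (Suc n) \<omega> \<le> X (Suc n) \<omega>"
        by (simp add: powr_minus_divide)
    qed
  qed (use gamma k \<epsilon> in auto)
  then have null: "(\<Union>n. B (Suc n)) \<in> null_sets P" by (rule null_sets_UN)
  have "{\<omega> \<in> space P. (\<lambda>n. X n \<omega>) \<longlonglongrightarrow> 0} \<subseteq> (\<Union>n. B (Suc n))"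
  proof clarify
    fix \<omega> assume \<omega>: "\<omega> \<in> space P" "(\<lambda>n. X n \<omega>) \<longlonglongrightarrow> 0"
    then obtain n where "\<And>m. n \<le> m \<Longrightarrow> \<bar>X m \<omega>\<bar> < \<epsilon>"
      using LIMSEQ_D[OF \<omega>(2) \<epsilon>(1)] by auto
    then show "\<omega> \<in> (\<Union>n. B (Suc n))" using \<omega> by (auto simp: B_def intro!: exI[of _ n] less_imp_le)
  qed
  then have "prob {\<omega> \<in> space P. (\<lambda>n. X n \<omega>) \<longlonglongrightarrow> 0} \<le> prob (\<Union>n. B (Suc n))"
    using null by (intro finite_measure_mono) auto
  also have "\<dots> = 0" using null by (simp add: measure_eq_0_null_sets)
  finally show ?thesis using measure_nonneg[of P "{\<omega> \<in> space P. (\<lambda>n. X n \<omega>) \<longlonglongrightarrow> 0}"] by linarith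
qed

end
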